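(* Let $\{(p_i,q_i):i=1,2,\dots,N\}$, $N>1$, be a data set of real points with $p_1<p_2<\dots<p_N$, let $I=[p_1,p_N]$, and let the vertical scaling factors $\alpha_1,\dots,\alpha_{N-1}$ be chosen between $0$ and $1$. Consider the iterated function system on $I\times\mathbb{R}$ given by $$w_i(p,q)=\Bigl(a_ip+b_i,\ \alpha_iq+A_ip+B_i-\alpha_i\Bigl(\frac{(q_N-q_1)p}{p_N-p_1}+\frac{p_Nq_1-p_1q_N}{p_N-p_1}\Bigr)\Bigr),\qquad i=1,\dots,N-1,$$ where $a_i,b_i,A_i,B_i$ are the coefficients determined by the data as described in the context. Then this iterated function system is hyperbolic with respect to the metric $\sigma_1$ defined by $$\sigma_1((p,q),(p',q'))=|p-p'|+\theta_1|q-q'|,$$ where $$\theta_1=\frac{\min\{1-|a_i|:i=1,2,\dots,N-1\}-\epsilon_1}{\max\bigl\{|A_i|+|\alpha_i|\bigl|\frac{q_N-q_1}{p_N-p_1}\bigr|:i=1,2,\dots,N-1\bigr\}},\qquad \epsilon_1>0.$$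
   Context: For $i=1,\dots,N-1$ let $I_i=[p_i,p_{i+1}]$, and let $S_i:I\to I_i$, $S_i(p)=a_ip+b_i$, be the contractive affine map with $S_i(p_1)=p_i$ and $S_i(p_N)=p_{i+1}$. Let $g:I\to\mathbb{R}$ be the piecewise linear interpolation function of the data, i.e. the continuous function that is affine on each $I_i$ with $g(p_i)=q_i$ for all $i$; then $g\circ S_i$ is affine on $I$, and $A_i,B_i$ are defined by $g(S_i(p))=A_ip+B_i$ for $p\in I$. The expression multiplied by $-\alpha_i$ in the second component of $w_i$ is the first degree Bernstein polynomial of $g$ on $I$. An iterated function system $\{w_i\}$ is hyperbolic with respect to a metric $\sigma$ if there is a constant $r$ with $0\le r<1$ such that $\sigma(w_i(X),w_i(Y))\le r\,\sigma(X,Y)$ for all $i$ and all points $X,Y$.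
   Formalization: Formally ε₁ is also required to be less than min{1−|a_i|} (otherwise θ₁≤0 and σ₁ is not a metric), the maximum in the denominator of θ₁ is required to be nonzero (it vanishes when all q_i are equal), and α_i=1 is excluded. *)

theory Defs
  imports "HOL-Analysis.Analysis"
begin

text \<open>
  Data points are functions on the indices \<open>1, \<dots>, N\<close>; the maps of the iterated function system
  are indexed by \<open>1, \<dots>, N - 1\<close>, written \<open>{1..<N}\<close>.
\<close>

definition piecewise_linear_interpolant ::
    "nat \<Rightarrow> (nat \<Rightarrow> real) \<Rightarrow> (nat \<Rightarrow> real) \<Rightarrow> (real \<Rightarrow> real) \<Rightarrow> bool" where
  "piecewise_linear_interpolant N p q g \<longleftrightarrow>
     continuous_on {p 1..p N} g \<and>
     (\<forall>i\<in>{1..<N}. \<exists>c d. \<forall>x\<in>{p i..p (Suc i)}. g x = c * x + d) \<and>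
     (\<forall>i\<in>{1..N}. g (p i) = q i)"

text \<open>The term multiplied by \<open>- \<alpha> i\<close> is the first degree Bernstein polynomial, on
  \<open>[p 1, p N]\<close>, of the interpolant of the data.\<close>

definition ifs_map ::
    "nat \<Rightarrow> (nat \<Rightarrow> real) \<Rightarrow> (nat \<Rightarrow> real) \<Rightarrow> (nat \<Rightarrow> real) \<Rightarrow>
     (nat \<Rightarrow> real) \<Rightarrow> (nat \<Rightarrow> real) \<Rightarrow> (nat \<Rightarrow> real) \<Rightarrow> (nat \<Rightarrow> real) \<Rightarrow>
     nat \<Rightarrow> real \<times> real \<Rightarrow> real \<times> real" where
  "ifs_map N p q \<alpha> a b A B i = (\<lambda>(x, y).
     (a i * x + b i,
      \<alpha> i * y + A i * x + B i
        - \<alpha> i * ((q N - q 1) * x / (p N - p 1) + (p N * q 1 - p 1 * q N) / (p N - p 1))))"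

definition weighted_dist :: "real \<Rightarrow> real \<times> real \<Rightarrow> real \<times> real \<Rightarrow> real" where
  "weighted_dist \<theta> = (\<lambda>(x, y) (x', y'). \<bar>x - x'\<bar> + \<theta> * \<bar>y - y'\<bar>)"

definition slope_bound ::
    "nat \<Rightarrow> (nat \<Rightarrow> real) \<Rightarrow> (nat \<Rightarrow> real) \<Rightarrow> (nat \<Rightarrow> real) \<Rightarrow> (nat \<Rightarrow> real) \<Rightarrow> real" where
  "slope_bound N p q \<alpha> A =
     Max ((\<lambda>i. \<bar>A i\<bar> + \<bar>\<alpha> i\<bar> * \<bar>(q N - q 1) / (p N - p 1)\<bar>) ` {1..<N})"

definition theta1 ::
    "nat \<Rightarrow> (nat \<Rightarrow> real) \<Rightarrow> (nat \<Rightarrow> real) \<Rightarrow> (nat \<Rightarrow> real) \<Rightarrow>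
     (nat \<Rightarrow> real) \<Rightarrow> (nat \<Rightarrow> real) \<Rightarrow> real \<Rightarrow> real" where
  "theta1 N p q \<alpha> a A \<epsilon> =
     (Min ((\<lambda>i. 1 - \<bar>a i\<bar>) ` {1..<N}) - \<epsilon>) / slope_bound N p q \<alpha> A"

text \<open>Besides the contraction inequality, this records that \<open>d\<close> is a metric on \<open>M\<close> and that
  the maps send \<open>M\<close> into itself.\<close>

definition hyperbolic_ifs ::
    "'x set \<Rightarrow> ('x \<Rightarrow> 'x \<Rightarrow> real) \<Rightarrow> 'i set \<Rightarrow> ('i \<Rightarrow> 'x \<Rightarrow> 'x) \<Rightarrow> bool" where
  "hyperbolic_ifs M d J w \<longleftrightarrow>
     Metric_space M d \<and>
     (\<forall>i\<in>J. w i \<in> M \<rightarrow> M) \<and>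
     (\<exists>r. 0 \<le> r \<and> r < 1 \<and> (\<forall>i\<in>J. \<forall>X\<in>M. \<forall>Y\<in>M. d (w i X) (w i Y) \<le> r * d X Y))"

end

theory Submission
  imports Defs
begin

text \<open>
  In the second coordinate, \<open>w\<^sub>i\<close> expands horizontal distances by at most the slope bound \<open>S\<close>, and
  the choice \<open>\<theta>\<^sub>1 * S = min (1 - \<bar>a\<^sub>i\<bar>) - \<epsilon>\<close> makes the weighted cost of this expansion smaller by
  \<open>\<epsilon>\<close> than what the horizontal contraction gains. Hence \<open>max (1 - \<epsilon>) (max \<alpha>\<^sub>i)\<close> is a contraction
  factor for all the maps.
\<close>

lemma Metric_space_weighted_dist:
  assumes "0 < \<theta>"
  shows "Metric_space M (weighted_dist \<theta>)"
proof
  fix X Y Z :: "real \<times> real"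
  show "0 \<le> weighted_dist \<theta> X Y"
    using assms by (simp add: weighted_dist_def split: prod.split)
  show "weighted_dist \<theta> X Y = weighted_dist \<theta> Y X"
    by (simp add: weighted_dist_def abs_minus_commute split: prod.split)
  \<comment> \<open>Definiteness needs \<theta> to be strictly positive: with weight 0, points on
    the same vertical line would be at distance 0.\<close>
  show "weighted_dist \<theta> X Y = 0 \<longleftrightarrow> X = Y"
    using assms by (auto simp: weighted_dist_def add_nonneg_eq_0_iff split: prod.split)
  obtain x y where X: "X = (x, y)" by fastforce
  obtain x' y' where Y: "Y = (x', y')" by fastforce
  obtain x'' y'' where Z: "Z = (x'', y'')" by fastforce
  have "\<theta> * \<bar>y - y''\<bar> \<le> \<theta> * (\<bar>y - y'\<bar> + \<bar>y' - y''\<bar>)"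
    using assms by (intro mult_left_mono) auto
  moreover have "\<bar>x - x''\<bar> \<le> \<bar>x - x'\<bar> + \<bar>x' - x''\<bar>"
    by simp
  ultimately show "weighted_dist \<theta> X Z \<le> weighted_dist \<theta> X Y + weighted_dist \<theta> Y Z"
    by (simp add: weighted_dist_def X Y Z algebra_simps)
qed

text \<open>The weighted distance of two images splits into a multiple of the horizontal separation
  and a multiple of the weighted vertical one. The horizontal separation pays twice, through
  \<open>a i\<close> and through the shear of the second coordinate, which costs \<theta> times its
  slope. So one bound per coefficient suffices.\<close>

lemma weighted_dist_ifs_map_le:
  assumes "0 \<le> \<theta>"
    and x_factor: "\<bar>a i\<bar> + \<theta> * (\<bar>A i\<bar> + \<bar>\<alpha> i\<bar> * \<bar>(q N - q 1) / (p N - p 1)\<bar>) \<le> r"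
    and y_factor: "\<bar>\<alpha> i\<bar> \<le> r"
  shows "weighted_dist \<theta> (ifs_map N p q \<alpha> a b A B i X) (ifs_map N p q \<alpha> a b A B i Y)
         \<le> r * weighted_dist \<theta> X Y"
proof -
  obtain x y where X: "X = (x, y)" by fastforce
  obtain x' y' where Y: "Y = (x', y')" by fastforce
  \<comment> \<open>\<open>c\<close> is the slope of the Bernstein polynomial, that is, of the chord
    joining the first and last data points. Its constant term cancels in differences of
    images.\<close>
  define c where "c = (q N - q 1) / (p N - p 1)"
  let ?X' = "ifs_map N p q \<alpha> a b A B i X" and ?Y' = "ifs_map N p q \<alpha> a b A B i Y"
  have "fst ?X' - fst ?Y' = a i * (x - x')"
    by (simp add: ifs_map_def X Y algebra_simps)
  then have fst: "\<bar>fst ?X' - fst ?Y'\<bar> = \<bar>a i\<bar> * \<bar>x - x'\<bar>"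
    by (simp add: abs_mult)
  have "(q N - q 1) * t / (p N - p 1) = c * t" for t
    by (simp add: c_def)
  then have snd: "snd ?X' - snd ?Y' = \<alpha> i * (y - y') + A i * (x - x') - \<alpha> i * (c * (x - x'))"
    by (simp add: ifs_map_def X Y algebra_simps)
  have "\<bar>snd ?X' - snd ?Y'\<bar> \<le> \<bar>\<alpha> i * (y - y')\<bar> + \<bar>A i * (x - x')\<bar> + \<bar>\<alpha> i * (c * (x - x'))\<bar>"
    unfolding snd by linarith
  also have "\<dots> = \<bar>\<alpha> i\<bar> * \<bar>y - y'\<bar> + (\<bar>A i\<bar> + \<bar>\<alpha> i\<bar> * \<bar>c\<bar>) * \<bar>x - x'\<bar>"
    by (simp add: abs_mult distrib_right)
  finally have "\<theta> * \<bar>snd ?X' - snd ?Y'\<bar>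
      \<le> \<theta> * (\<bar>\<alpha> i\<bar> * \<bar>y - y'\<bar> + (\<bar>A i\<bar> + \<bar>\<alpha> i\<bar> * \<bar>c\<bar>) * \<bar>x - x'\<bar>)"
    using \<open>0 \<le> \<theta>\<close> by (rule mult_left_mono)
  then have "weighted_dist \<theta> ?X' ?Y'
      \<le> (\<bar>a i\<bar> + \<theta> * (\<bar>A i\<bar> + \<bar>\<alpha> i\<bar> * \<bar>c\<bar>)) * \<bar>x - x'\<bar> + \<bar>\<alpha> i\<bar> * (\<theta> * \<bar>y - y'\<bar>)"
    by (simp add: weighted_dist_def case_prod_beta fst algebra_simps)
  also have "\<dots> \<le> r * \<bar>x - x'\<bar> + r * (\<theta> * \<bar>y - y'\<bar>)"
    using \<open>0 \<le> \<theta>\<close> x_factor y_factor unfolding c_def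
    by (intro add_mono mult_right_mono) auto
  also have "\<dots> = r * weighted_dist \<theta> X Y"
    by (simp add: weighted_dist_def X Y algebra_simps)
  finally show ?thesis .
qed

text \<open>No sign of \<open>a\<close> is assumed: the order of the endpoint images forces
  \<open>0 \<le> a\<close>, unless the interval is a single point.\<close>

lemma affine_image_between:
  fixes a b l u x :: real
  assumes "l \<le> x" "x \<le> u" "a * l + b \<le> a * u + b"
  shows "a * l + b \<le> a * x + b" "a * x + b \<le> a * u + b"
proof -
  have "0 \<le> a \<or> l = x \<and> x = u"
    using assms by (smt (verit) mult_left_less_imp_less mult_less_cancel_left)
  then show "a * l + b \<le> a * x + b" "a * x + b \<le> a * u + b"
    using assms by (auto intro: mult_left_mono)
qed

theorem lemma3p1:
  fixes N :: nat and p q \<alpha> a b A B :: "nat \<Rightarrow> real" and g :: "real \<Rightarrow> real" and \<epsilon> :: real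
  assumes "N > 1"
    and "strict_mono_on {1..N} p"
    and "\<And>i. i \<in> {1..<N} \<Longrightarrow> 0 \<le> \<alpha> i \<and> \<alpha> i < 1"
    and "\<And>i. i \<in> {1..<N} \<Longrightarrow> a i * p 1 + b i = p i"
    and "\<And>i. i \<in> {1..<N} \<Longrightarrow> a i * p N + b i = p (Suc i)"
    and "\<And>i. i \<in> {1..<N} \<Longrightarrow> \<bar>a i\<bar> < 1"
    and "piecewise_linear_interpolant N p q g"
    and "\<And>i x. i \<in> {1..<N} \<Longrightarrow> x \<in> {p 1..p N} \<Longrightarrow> g (a i * x + b i) = A i * x + B i"
    and "slope_bound N p q \<alpha> A \<noteq> 0"
    and "0 < \<epsilon>"
    and "\<epsilon> < Min ((\<lambda>i. 1 - \<bar>a i\<bar>) ` {1..<N})"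
  shows "hyperbolic_ifs ({p 1..p N} \<times> UNIV) (weighted_dist (theta1 N p q \<alpha> a A \<epsilon>))
           {1..<N} (ifs_map N p q \<alpha> a b A B)"
proof -
  define m where "m = Min ((\<lambda>i. 1 - \<bar>a i\<bar>) ` {1..<N})"
  define S where "S = slope_bound N p q \<alpha> A"
  define \<theta> where "\<theta> = theta1 N p q \<alpha> a A \<epsilon>"
  define r where "r = max (1 - \<epsilon>) (Max (\<alpha> ` {1..<N}))"
  have ne: "{1..<N} \<noteq> {}"
    using assms(1) by auto
  have slope_le: "\<bar>A i\<bar> + \<bar>\<alpha> i\<bar> * \<bar>(q N - q 1) / (p N - p 1)\<bar> \<le> S" if "i \<in> {1..<N}" for i
    unfolding S_def slope_bound_def using that by (intro Max_ge) auto
  have m_le: "m \<le> 1 - \<bar>a i\<bar>" if "i \<in> {1..<N}" for i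
    unfolding m_def using that by (intro Min_le) auto
  have one: "1 \<in> {1..<N}"
    using assms(1) by auto
  have "0 \<le> \<bar>A 1\<bar> + \<bar>\<alpha> 1\<bar> * \<bar>(q N - q 1) / (p N - p 1)\<bar>"
    by simp
  \<comment> \<open>As a maximum of nonnegative terms \<open>S\<close> cannot be negative, so being
    nonzero makes it positive.\<close>
  with slope_le[OF one] have "0 < S"
    using assms(9) unfolding S_def by linarith
  have \<theta>_S: "\<theta> * S = m - \<epsilon>"
    using assms(9) by (simp add: \<theta>_def theta1_def S_def m_def)
  have "0 < \<theta>"
    using \<open>0 < S\<close> assms(11) by (simp add: \<theta>_def theta1_def S_def)
  \<comment> \<open>Here \<open>\<epsilon> < m\<close> and
    \<open>m \<le> 1 - \<bar>a 1\<bar> \<le> 1\<close>, so already \<open>1 - \<epsilon>\<close> is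
    positive.\<close>
  have "0 \<le> r"
    using m_le[OF one] assms(11) unfolding r_def m_def by linarith
  \<comment> \<open>The bound on the scaling factors stays strict for their maximum because there
    are finitely many of them, and at least one.\<close>
  have "r < 1"
    using assms(3,10) ne by (simp add: r_def)
  have \<alpha>_le: "\<bar>\<alpha> i\<bar> \<le> r" if "i \<in> {1..<N}" for i
  proof -
    have "\<alpha> i \<le> Max (\<alpha> ` {1..<N})"
      using that by (intro Max_ge) auto
    then show ?thesis
      using assms(3)[OF that] by (simp add: r_def)
  qed
  have x_factor: "\<bar>a i\<bar> + \<theta> * (\<bar>A i\<bar> + \<bar>\<alpha> i\<bar> * \<bar>(q N - q 1) / (p N - p 1)\<bar>) \<le> r"
    if "i \<in> {1..<N}" for i
  proof -
    have "\<theta> * (\<bar>A i\<bar> + \<bar>\<alpha> i\<bar> * \<bar>(q N - q 1) / (p N - p 1)\<bar>) \<le> \<theta> * S"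
      using slope_le[OF that] \<open>0 < \<theta>\<close> by (intro mult_left_mono) auto
    \<comment> \<open>The two costs add up to at most
      \<open>(1 - m) + (m - \<epsilon>) = 1 - \<epsilon>\<close>.\<close>
    with m_le[OF that] show ?thesis
      unfolding \<theta>_S r_def by linarith
  qed
  have maps: "ifs_map N p q \<alpha> a b A B i \<in> {p 1..p N} \<times> UNIV \<rightarrow> {p 1..p N} \<times> UNIV"
    if i: "i \<in> {1..<N}" for i
  proof -
    have mono: "p j \<le> p k" if "j \<le> k" "1 \<le> j" "k \<le> N" for j k
      using assms(2) that by (intro strict_mono_on_leD[of "{1..N}" p]) auto
    have order: "p 1 \<le> p i" "p i \<le> p (Suc i)" "p (Suc i) \<le> p N"
      using i by (auto intro: mono)
    \<comment> \<open>Only the first coordinate is constrained. It lands between \<open>p i\<close>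
      and \<open>p (Suc i)\<close>, the images of the endpoints, hence in the whole
      interval.\<close>
    have "p 1 \<le> a i * x + b i \<and> a i * x + b i \<le> p N" if "p 1 \<le> x" "x \<le> p N" for x
      using affine_image_between[OF that, of "a i" "b i"] assms(4,5)[OF i] order by linarith
    then show ?thesis
      by (auto simp: ifs_map_def)
  qed
  show ?thesis
    unfolding hyperbolic_ifs_def \<theta>_def[symmetric]
  proof (intro conjI exI ballI)
    show "Metric_space ({p 1..p N} \<times> UNIV) (weighted_dist \<theta>)"
      using \<open>0 < \<theta>\<close> by (rule Metric_space_weighted_dist)
    show "0 \<le> r" "r < 1"
      by fact+
    show "ifs_map N p q \<alpha> a b A B i \<in> {p 1..p N} \<times> UNIV \<rightarrow> {p 1..p N} \<times> UNIV"
      if "i \<in> {1..<N}" for i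
      using that by (rule maps)
    show "weighted_dist \<theta> (ifs_map N p q \<alpha> a b A B i X) (ifs_map N p q \<alpha> a b A B i Y)
          \<le> r * weighted_dist \<theta> X Y" if "i \<in> {1..<N}" for i X Y
      using \<open>0 < \<theta>\<close> x_factor[OF that] \<alpha>_le[OF that]
      by (intro weighted_dist_ifs_map_le) auto
  qed
qed

end
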